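(* Define the random vector $\boldsymbol V=(V_\lambda)_{\lambda\in\Lambda}$ in $\mathbb R^\Lambda$ by $$\mathbb P(\boldsymbol V\in d\boldsymbol v)=\mu_n(d\boldsymbol v)=\frac{1}{\mathfrak Z_{n,\beta}}\,f_{\boldsymbol Z_\beta}(\boldsymbol v)\prod_{\lambda\in\Lambda}\cosh(v_\lambda)\,dv_\lambda,\qquad f_{\boldsymbol Z_\beta}(\boldsymbol v)=\frac{e^{-\frac{\beta^{-1}}{2}\,{}^t\boldsymbol v\,C^{-1}\boldsymbol v}}{\sqrt{\det(2\pi\beta C)}},$$ where $\mathfrak Z_{n,\beta}:=\mathbb E\left(e^{\frac12\,{}^t\boldsymbol B\,C_\beta\boldsymbol B}\right)$. Then one has the randomisation identity $$\left(B_\lambda^{*\beta}\right)_{\lambda\in\Lambda}\;\overset{\mathrm{law}}{=}\;\boldsymbol B[\boldsymbol V]:=\left(B_\lambda[V_\lambda]\right)_{\lambda\in\Lambda}.$$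
   Context: Let $\mathcal G=(\Lambda,\mathcal E)$ be a finite graph with vertex set $\Lambda=\Lambda_{n,d}$ (for instance $\{1,\dots,N\}^d$), and write $i\sim j$ if $\{i,j\}\in\mathcal E$. Let $\beta>0$ be the inverse temperature, let $C$ be the adjacency matrix of $\mathcal G$, $C[i,j]=\mathbf 1_{\{i\sim j\}}$, and let $C_\beta=\beta C$. Let $\boldsymbol B=(B_\lambda)_{\lambda\in\Lambda}$ be i.i.d. uniform on $\{-1,1\}$. Since ${}^t\boldsymbol B\boldsymbol B=|\Lambda|$, one can always modify the diagonal of $C$ by adding a multiple $\gamma I_{|\Lambda|}$ of the identity to turn $C$ into an invertible matrix, the additional constant in the exponential being absorbed into the normalisation constant; $C$ is understood to be invertible in this sense. The Ising spins are the random vector $\boldsymbol B^{*\beta}=(B_\lambda^{*\beta})_{\lambda\in\Lambda}$ in $\{-1,1\}^\Lambda$ whose law has density $e^{\frac12\,{}^t\boldsymbol B\,C_\beta\boldsymbol B}/\mathbb E\left(e^{\frac12\,{}^t\boldsymbol B\,C_\beta\boldsymbol B}\right)$ with respect to the law of $\boldsymbol B$. The logistic function is $\psi(\alpha)=\frac{e^\alpha}{e^\alpha+e^{-\alpha}}=\frac12(1+\tanh\alpha)$, $\alpha\in\mathbb R$. For $\alpha\in\mathbb R$, $B_\lambda[\alpha]$ denotes a $\{-1,1\}$-valued random variable with $\mathbb P(B_\lambda[\alpha]=1)=\psi(\alpha)$, these being independent over $\lambda\in\Lambda$; in $\boldsymbol B[\boldsymbol V]$ the variables $B_\lambda[V_\lambda]$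 are, conditionally on $\boldsymbol V$, independent with $\mathbb P(B_\lambda[V_\lambda]=1\mid\boldsymbol V)=\psi(V_\lambda)$. ${}^t$ denotes transposition.
   Formalization: The law of V is shown to be a probability measure only when C (adjacency matrix plus a multiple of the identity) is positive definite; for merely invertible C that is not positive definite, the stated density is undefined or not integrable, so V does not exist. *)

theory Defs
  imports "HOL-Probability.Probability"
begin

definition logistic :: "real \<Rightarrow> real" where
  "logistic a = exp a / (exp a + exp (- a))"

text \<open>The vertex set is the finite type \<open>'n\<close>; a simple graph is given by its set of edges.\<close>

definition simple_graph :: "'n set set \<Rightarrow> bool" where
  "simple_graph E \<longleftrightarrow> (\<forall>e\<in>E. card e = 2)"

definition adjacency_matrix :: "'n set set \<Rightarrow> real^'n^'n" where
  "adjacency_matrix E = (\<chi> i j. if {i, j} \<in> E then 1 else 0)"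

definition uniform_spins :: "(real^'n) pmf" where
  "uniform_spins = map_pmf vec_lambda (Pi_pmf UNIV 0 (\<lambda>_. pmf_of_set {- 1, 1}))"

definition boltzmann_weight :: "real \<Rightarrow> real^'n^'n \<Rightarrow> real^'n \<Rightarrow> real" where
  "boltzmann_weight \<beta> C b = exp (1 / 2 * (b \<bullet> ((\<beta> *\<^sub>R C) *v b)))"

definition partition_function :: "real \<Rightarrow> real^'n^'n \<Rightarrow> real" where
  "partition_function \<beta> C = measure_pmf.expectation uniform_spins (boltzmann_weight \<beta> C)"

text \<open>The law of the uniform spins is pushed forward to the Borel sets, so that it lives on the
  same measurable space as the laws of random vectors.\<close>

definition ising_law :: "real \<Rightarrow> real^'n^'n \<Rightarrow> (real^'n) measure" where
  "ising_law \<beta> C = density (distr (measure_pmf uniform_spins) borel (\<lambda>b. b))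
     (\<lambda>b. ennreal (boltzmann_weight \<beta> C b / partition_function \<beta> C))"

definition gaussian_density :: "real \<Rightarrow> real^'n^'n \<Rightarrow> real^'n \<Rightarrow> real" where
  "gaussian_density \<beta> C v =
     exp (- (inverse \<beta> / 2) * (v \<bullet> (matrix_inv C *v v))) / sqrt (det ((2 * pi * \<beta>) *\<^sub>R C))"

text \<open>For an invertible symmetric \<open>C\<close> this is a probability measure only if \<open>C\<close> is positive definite:
  otherwise \<open>det C\<close> is negative or the density is not integrable.\<close>

definition field_law :: "real \<Rightarrow> real^'n^'n \<Rightarrow> (real^'n) measure" where
  "field_law \<beta> C = density lborel
     (\<lambda>v. ennreal (1 / partition_function \<beta> C * gaussian_density \<beta> C v * (\<Prod>i\<in>UNIV. cosh (v $ i))))"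

definition random_vector :: "'w measure \<Rightarrow> ('w \<Rightarrow> real^'n) \<Rightarrow> bool" where
  "random_vector M X \<longleftrightarrow> prob_space M \<and> X \<in> borel_measurable M"

text \<open>A version of the conditional probability of the event that \<open>P\<close> holds, given
  the sigma-algebra generated by \<open>V\<close>.\<close>

definition cond_prob_given ::
  "'w measure \<Rightarrow> ('w \<Rightarrow> real^'n) \<Rightarrow> ('w \<Rightarrow> bool) \<Rightarrow> 'w \<Rightarrow> real" where
  "cond_prob_given M V P =
     real_cond_exp M (vimage_algebra (space M) V borel) (indicator {x \<in> space M. P x})"

text \<open>\<open>randomised_spins M V W\<close> says that \<open>W\<close> is a realisation of \<open>B[V]\<close>: a spin configuration whose
  coordinates are, conditionally on \<open>V\<close>, independent and equal to 1 with probability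
  \<open>logistic (V\<^sub>i)\<close>. Subfamilies in the independence condition are covered by taking \<open>A i = UNIV\<close>.\<close>

definition randomised_spins :: "'w measure \<Rightarrow> ('w \<Rightarrow> real^'n) \<Rightarrow> ('w \<Rightarrow> real^'n) \<Rightarrow> bool" where
  "randomised_spins M V W \<longleftrightarrow>
     random_vector M W \<and>
     (\<forall>x\<in>space M. \<forall>i. W x $ i \<in> {- 1, 1}) \<and>
     (\<forall>A. (\<forall>i. A i \<in> sets borel) \<longrightarrow>
        (AE x in M. cond_prob_given M V (\<lambda>y. \<forall>i. W y $ i \<in> A i) x
                  = (\<Prod>i\<in>UNIV. cond_prob_given M V (\<lambda>y. W y $ i \<in> A i) x))) \<and>
     (\<forall>i. AE x in M. cond_prob_given M V (\<lambda>y. W y $ i = 1) x = logistic (V x $ i))"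

end

theory Submission
  imports Defs
begin

text \<open>
  The identity is a Hubbard--Stratonovich transformation. Given \<open>V = v\<close>, a spin configuration \<open>b\<close> has
  probability \<open>\<Prod>\<^sub>i logistic (b\<^sub>i v\<^sub>i) = \<Prod>\<^sub>i exp (b\<^sub>i v\<^sub>i) / (2 cosh v\<^sub>i)\<close>. The weight \<open>\<Prod>\<^sub>i cosh v\<^sub>i\<close> in the
  field law cancels the denominators, so the unconditional probability of \<open>b\<close> is, up to the factor \<open>2\<^sup>-\<^sup>n\<close>
  and the partition function, the exponential moment \<open>E exp (b \<bullet> Z\<^sub>\<beta>)\<close> of a Gaussian vector with
  covariance \<open>\<beta> C\<close>, which is the Boltzmann weight of \<open>b\<close>
  (\<open>nn_integral_gaussian_density_exp\<close>). This is the mass that the Ising law gives to \<open>b\<close>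
  (\<open>nn_integral_field_law_logistic\<close>, \<open>prob_randomised_spins_eq\<close>). Since
  \<open>\<Prod>\<^sub>i cosh v\<^sub>i\<close> is the mean of \<open>exp (b \<bullet> v)\<close> over all \<open>b\<close>, the same exponential moments show that the
  field law has total mass 1 (\<open>prob_space_field_law\<close>).

  The computation needs \<open>C\<close> to be positive definite. For the identity of laws this follows from the
  existence of \<open>V\<close>: otherwise the Gaussian weight is at least a positive constant on an open cone, or
  its normalising constant has the wrong sign, and the field law is no probability measure
  (\<open>posdef_of_prob_space_field_law\<close>).

  The exponential moments come from the Gaussian integral over \<open>real^'n\<close>, obtained by a linear
  substitution that turns the quadratic form into the Euclidean norm (\<open>posdef_congruent_identity\<close>).
  The rule for linear substitutions is obtained by factoring a matrix into elementary ones (\<open>nn_integral_lborel_linear\<close>).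
\<close>

section \<open>Linear change of variables for Lebesgue measure\<close>

lemma Basis_vec_eq_range: "(Basis :: (real^'n) set) = range (\<lambda>i. axis i 1)"
  by (auto simp: Basis_vec_def)

lemma prod_Basis_vec:
  fixes g :: "real^'n \<Rightarrow> 'a :: comm_monoid_mult"
  shows "(\<Prod>b\<in>Basis. g b) = (\<Prod>i\<in>UNIV. g (axis i 1))"
  unfolding Basis_vec_eq_range by (subst prod.reindex) (auto simp: inj_on_def axis_eq_axis)

lemma borel_measurable_vec_lambda:
  assumes "\<And>i. (\<lambda>x. g x i) \<in> borel_measurable M"
  shows "(\<lambda>x. (\<chi> i. g x i) :: real^'n) \<in> borel_measurable M"
  using assms by (subst borel_measurable_euclidean_space) (auto simp: Basis_vec_def inner_axis)

lemma borel_measurable_vec_nth [measurable]: "(\<lambda>v :: real^'n. v $ i) \<in> borel_measurable borel"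
  by (simp add: cart_eq_inner_axis)

lemma borel_measurable_vec_lambda_PiM:
  "vec_lambda \<in> Pi\<^sub>M UNIV (\<lambda>_. lborel) \<rightarrow>\<^sub>M (borel :: (real^'n) measure)"
  by (intro borel_measurable_vec_lambda[of "\<lambda>x i. x i"]) auto

lemma lborel_vec: "(lborel :: (real^'n) measure) = distr (Pi\<^sub>M UNIV (\<lambda>_. lborel)) borel vec_lambda"
proof (rule lborel_eqI)
  interpret product_sigma_finite "\<lambda>_::'n. lborel :: real measure" ..
  fix l u :: "real^'n"
  assume le: "\<And>b. b \<in> Basis \<Longrightarrow> l \<bullet> b \<le> u \<bullet> b"
  have le': "l $ i \<le> u $ i" for i
    using le[of "axis i 1"] by (simp add: cart_eq_inner_axis)
  have "vec_lambda -` box l u \<inter> space (Pi\<^sub>M UNIV (\<lambda>_. lborel)) = Pi\<^sub>E UNIV (\<lambda>i. {l $ i <..< u $ i})"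
    by (auto simp: space_PiM mem_box_cart PiE_iff)
  then have "emeasure (distr (Pi\<^sub>M UNIV (\<lambda>_. lborel)) borel vec_lambda) (box l u) = (\<Prod>i\<in>UNIV. ennreal (u $ i - l $ i))"
    using borel_measurable_vec_lambda_PiM le'
    by (subst emeasure_distr) (simp_all add: emeasure_PiM)
  also have "\<dots> = ennreal (\<Prod>i\<in>UNIV. u $ i - l $ i)"
    using le' by (simp add: prod_ennreal)
  also have "(\<Prod>i\<in>UNIV. u $ i - l $ i) = (\<Prod>b\<in>Basis. (u - l) \<bullet> b)"
    by (simp add: prod_Basis_vec inner_axis)
  finally show "emeasure (distr (Pi\<^sub>M UNIV (\<lambda>_. lborel)) borel vec_lambda) (box l u) = (\<Prod>b\<in>Basis. (u - l) \<bullet> b)" .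
qed simp

lemma nn_integral_lborel_vec:
  fixes f :: "real^'n \<Rightarrow> ennreal"
  assumes "f \<in> borel_measurable borel"
  shows "(\<integral>\<^sup>+v. f v \<partial>lborel) = (\<integral>\<^sup>+x. f (vec_lambda x) \<partial>Pi\<^sub>M UNIV (\<lambda>_. lborel))"
  by (subst lborel_vec) (simp add: nn_integral_distr borel_measurable_vec_lambda_PiM assms)

lemma borel_measurable_mult_vec [measurable]: "(*v) (A :: real^'n^'m) \<in> borel_measurable borel"
  by (intro borel_measurable_continuous_onI linear_continuous_on) (simp add: linear_linear)

text \<open>Fubini singles out the coordinate that the shear changes. The shear acts on it as a
  translation by an amount that depends on the other coordinates only, and one-dimensional
  Lebesgue measure is invariant under translations.\<close>

lemma nn_integral_lborel_shear:
  fixes f :: "real^'n \<Rightarrow> ennreal"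
  assumes [measurable]: "f \<in> borel_measurable borel" and mn: "m \<noteq> n"
  shows "(\<integral>\<^sup>+v. f (v + axis m (v $ n)) \<partial>lborel) = (\<integral>\<^sup>+v. f v \<partial>lborel)"
proof -
  interpret product_sigma_finite "\<lambda>_::'n. lborel :: real measure" ..
  note borel_measurable_vec_lambda_PiM [measurable]
  have U: "UNIV = insert m (UNIV - {m})" by auto
  have eq: "integral\<^sup>N (Pi\<^sub>M UNIV (\<lambda>_. lborel)) h
      = (\<integral>\<^sup>+ x. (\<integral>\<^sup>+ y. h (x(m := y)) \<partial>lborel) \<partial>(Pi\<^sub>M (UNIV - {m}) (\<lambda>_. lborel)))"
    if "h \<in> borel_measurable (Pi\<^sub>M UNIV (\<lambda>_. lborel :: real measure))" for h
    using product_nn_integral_insert[of "UNIV - {m}" m h] that U by simp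
  have [measurable]: "(\<lambda>v. f (v + axis m (v $ n))) \<in> borel_measurable borel"
  proof -
    have "(\<lambda>v :: real^'n. v + axis m (v $ n)) \<in> borel_measurable borel"
      unfolding axis_def by (intro borel_measurable_add borel_measurable_vec_lambda) auto
    then show ?thesis by measurable
  qed
  have "(\<integral>\<^sup>+ y. f (vec_lambda (x(m := y)) + axis m (vec_lambda (x(m := y)) $ n)) \<partial>lborel)
      = (\<integral>\<^sup>+ y. f (vec_lambda (x(m := y))) \<partial>lborel)" (is "?l = _") 
    if x: "x \<in> space (Pi\<^sub>M (UNIV - {m}) (\<lambda>_. lborel))" for x
  proof -
    have [measurable]: "(\<lambda>y. vec_lambda (x(m := y)) :: real^'n) \<in> borel_measurable borel"
      unfolding fun_upd_def
      by (intro borel_measurable_vec_lambda) auto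
    have "?l = (\<integral>\<^sup>+ y. f (vec_lambda (x(m := x n + 1 * y))) \<partial>lborel)"
      using mn by (intro nn_integral_cong arg_cong[where f=f]) (auto simp: vec_eq_iff axis_def)
    also have "\<dots> = (\<integral>\<^sup>+ y. f (vec_lambda (x(m := y))) \<partial>lborel)"
      by (subst (2) nn_integral_real_affine[where c=1 and t="x n"]) auto
    finally show ?thesis .
  qed
  note inner = this
  have "(\<integral>\<^sup>+v. f (v + axis m (v $ n)) \<partial>lborel)
      = (\<integral>\<^sup>+x. f (vec_lambda x + axis m (vec_lambda x $ n)) \<partial>Pi\<^sub>M UNIV (\<lambda>_. lborel))"
    by (intro nn_integral_lborel_vec) simp
  also have "\<dots> = (\<integral>\<^sup>+ x. (\<integral>\<^sup>+ y. f (vec_lambda (x(m := y)) + axis m (vec_lambda (x(m := y)) $ n)) \<partial>lborel)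
      \<partial>(Pi\<^sub>M (UNIV - {m}) (\<lambda>_. lborel)))"
    by (intro eq measurable_compose[OF borel_measurable_vec_lambda_PiM]) simp
  also have "\<dots> = (\<integral>\<^sup>+ x. (\<integral>\<^sup>+ y. f (vec_lambda (x(m := y))) \<partial>lborel)
      \<partial>(Pi\<^sub>M (UNIV - {m}) (\<lambda>_. lborel)))"
    by (intro nn_integral_cong inner)
  also have "\<dots> = (\<integral>\<^sup>+v. f v \<partial>lborel)"
    by (subst eq[symmetric]) (simp_all add: nn_integral_lborel_vec)
  finally show ?thesis .
qed

text \<open>The preimage of a box is the box with two of its coordinates interchanged, and boxes determine
  Lebesgue measure.\<close>

lemma lborel_transpose_coordinates:
  "(lborel :: (real^'n) measure)
     = distr lborel borel (\<lambda>v. \<chi> i. v $ Transposition.transpose m n i)"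
proof (rule lborel_eqI)
  let ?T = "\<lambda>v :: real^'n. \<chi> i. v $ Transposition.transpose m n i"
  have [measurable]: "?T \<in> borel_measurable borel"
    by (intro borel_measurable_vec_lambda) simp
  fix l u :: "real^'n"
  assume le: "\<And>b. b \<in> Basis \<Longrightarrow> l \<bullet> b \<le> u \<bullet> b"
  have prod_eq: "(\<Prod>b\<in>Basis. (w :: real^'n) \<bullet> b) = (\<Prod>i\<in>UNIV. w $ i)" for w
    by (simp add: prod_Basis_vec inner_axis)
  have le': "l $ i \<le> u $ i" for i
    using le[of "axis i 1"] by (simp add: cart_eq_inner_axis)
  have "?T -` box l u = box (?T l) (?T u)"
    by (auto simp: mem_box_cart) (metis transpose_involutory)+
  then have "emeasure (distr lborel borel ?T) (box l u) = emeasure lborel (box (?T l) (?T u))"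
    by (simp add: emeasure_distr)
  also have "\<dots> = ennreal (\<Prod>i\<in>UNIV. (u - l) $ Transposition.transpose m n i)"
    using le' by (simp add: emeasure_lborel_box_eq prod_eq) (simp add: Basis_vec_def inner_axis)
  also have "(\<Prod>i\<in>UNIV. (u - l) $ Transposition.transpose m n i) = (\<Prod>i\<in>UNIV. (u - l) $ i)"
    by (rule prod.reindex_bij_witness[of _ "Transposition.transpose m n" "Transposition.transpose m n"]) auto
  finally show "emeasure (distr lborel borel ?T) (box l u) = (\<Prod>b\<in>Basis. (u - l) \<bullet> b)"
    by (simp add: prod_eq)
qed simp

lemma nn_integral_lborel_diagonal:
  fixes f :: "real^'n \<Rightarrow> ennreal"
  assumes [measurable]: "f \<in> borel_measurable borel" and c: "\<And>i. c i \<noteq> 0"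
  shows "(\<integral>\<^sup>+v. f v \<partial>lborel) = ennreal (\<Prod>i\<in>UNIV. \<bar>c i\<bar>) * (\<integral>\<^sup>+v. f (\<chi> i. c i * v $ i) \<partial>lborel)"
proof -
  define d where "d b = c (SOME i. b = axis i (1 :: real))" for b :: "real^'n"
  have d: "d (axis i 1) = c i" for i by (simp add: d_def axis_eq_axis)
  have T: "0 + (\<Sum>j\<in>Basis. (d j * (v \<bullet> j)) *\<^sub>R j) = (\<chi> i. c i * v $ i)" for v
  proof -
    have "(\<Sum>j\<in>Basis. (d j * (v \<bullet> j)) *\<^sub>R j) = (\<Sum>i\<in>UNIV. (c i * v $ i) *\<^sub>R axis i 1)"
      unfolding Basis_vec_eq_range
      by (subst sum.reindex) (auto simp: inj_on_def axis_eq_axis inner_axis d)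
    also have "\<dots> = (\<chi> i. c i * v $ i)"
      by (simp add: vec_eq_iff axis_def if_distrib cong: if_cong)
    finally show ?thesis by simp
  qed
  have P: "(\<Prod>j\<in>Basis. \<bar>d j\<bar>) = (\<Prod>i\<in>UNIV. \<bar>c i\<bar>)"
    by (simp add: prod_Basis_vec d)
  have [measurable]: "(\<lambda>v::real^'n. \<chi> i. c i * v $ i) \<in> borel_measurable borel"
    by (intro borel_measurable_vec_lambda) simp
  have "(lborel :: (real^'n) measure) = density (distr lborel borel (\<lambda>v. \<chi> i. c i * v $ i)) (\<lambda>_. ennreal (\<Prod>i\<in>UNIV. \<bar>c i\<bar>))"
    using lborel_affine_euclidean[of d 0, unfolded T P] c by (force simp: Basis_vec_eq_range d)
  then have "(\<integral>\<^sup>+v. f v \<partial>lborel) = (\<integral>\<^sup>+v. f v \<partial>density (distr lborel borel (\<lambda>v. \<chi> i. c i * v $ i)) (\<lambda>_. ennreal (\<Prod>i\<in>UNIV. \<bar>c i\<bar>)))"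
    by simp
  also have "\<dots> = ennreal (\<Prod>i\<in>UNIV. \<bar>c i\<bar>) * (\<integral>\<^sup>+v. f (\<chi> i. c i * v $ i) \<partial>lborel)"
    by (subst nn_integral_density) (auto simp: nn_integral_distr nn_integral_cmult)
  finally show ?thesis .
qed

text \<open>Every matrix is a product of diagonal matrices, transpositions, shears and matrices with
  a zero row; the last kind does not occur when \<open>det A \<noteq> 0\<close>. The rule passes to products because the
  determinant is multiplicative, so it is enough to treat the other three kinds.\<close>

lemma nn_integral_lborel_linear:
  fixes A :: "real^'n^'n"
  assumes "f \<in> borel_measurable borel" and "det A \<noteq> 0"
  shows "(\<integral>\<^sup>+v. f v \<partial>lborel) = ennreal \<bar>det A\<bar> * (\<integral>\<^sup>+v. f (A *v v) \<partial>lborel)"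
proof -
  define P where "P A \<longleftrightarrow> (det A \<noteq> 0 \<longrightarrow> (\<forall>f\<in>borel_measurable borel.
      (\<integral>\<^sup>+v. f v \<partial>lborel) = ennreal \<bar>det A\<bar> * (\<integral>\<^sup>+v. f (A *v v) \<partial>lborel)))"
    for A :: "real^'n^'n"
  have "P A"
  proof (rule induct_matrix_elementary_alt[of P])
    fix A B assume AB: "P A" "P B"
    show "P (A ** B)" unfolding P_def
    proof (intro impI ballI)
      fix f :: "real^'n \<Rightarrow> ennreal"
      assume nz: "det (A ** B) \<noteq> 0" and [measurable]: "f \<in> borel_measurable borel"
      from nz have nzA: "det A \<noteq> 0" and nzB: "det B \<noteq> 0"
        by (simp_all add: det_mul)
      have "(\<integral>\<^sup>+v. f v \<partial>lborel) = ennreal \<bar>det A\<bar> * (\<integral>\<^sup>+v. f (A *v v) \<partial>lborel)"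
        by (rule AB(1)[unfolded P_def, rule_format, OF nzA]) simp
      also have "(\<integral>\<^sup>+v. f (A *v v) \<partial>lborel) = ennreal \<bar>det B\<bar> * (\<integral>\<^sup>+v. f (A *v (B *v v)) \<partial>lborel)"
        by (rule AB(2)[unfolded P_def, rule_format, OF nzB]) simp
      finally show "(\<integral>\<^sup>+v. f v \<partial>lborel) = ennreal \<bar>det (A ** B)\<bar> * (\<integral>\<^sup>+v. f (A ** B *v v) \<partial>lborel)"
        by (simp add: det_mul abs_mult ennreal_mult mult.assoc matrix_vector_mul_assoc)
    qed
  next
    fix A :: "real^'n^'n" and i assume "row i A = 0"
    then show "P A" by (simp add: det_zero_row P_def)
  next
    fix A :: "real^'n^'n" assume 3: "\<And>i j. i \<noteq> j \<Longrightarrow> A $ i $ j = 0"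
    have A: "A *v v = (\<chi> i. A $ i $ i * v $ i)" for v
    proof -
      have "(\<Sum>j\<in>UNIV. A $ i $ j * v $ j) = A $ i $ i * v $ i" for i
        by (subst sum.remove[of _ i]) (auto simp: 3)
      then show ?thesis by (simp add: matrix_vector_mult_def vec_eq_iff)
    qed
    have d: "det A = (\<Prod>i\<in>UNIV. A $ i $ i)" by (rule det_diagonal) (use 3 in auto)
    show "P A" unfolding P_def A d abs_prod
      by (auto intro!: nn_integral_lborel_diagonal)
  next
    fix m n :: 'n assume "m \<noteq> n"
    let ?S = "(\<chi> i j. mat 1 $ i $ Transposition.transpose m n j) :: real^'n^'n"
    have S: "?S *v v = (\<chi> i. v $ Transposition.transpose m n i)" for v
    proof -
      have "mat 1 $ i $ Transposition.transpose m n j = (if j = Transposition.transpose m n i then 1 else (0::real))" for i j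
        unfolding mat_def by auto
      then show ?thesis
        by (simp add: matrix_vector_mult_def vec_eq_iff if_distrib[of "\<lambda>x. x * _"] cong: if_cong)
    qed
    have d: "\<bar>det ?S\<bar> = 1"
      using det_permute_columns[of "Transposition.transpose m n" "mat 1 :: real^'n^'n"] 
      by (simp add: permutes_swap_id abs_mult sign_swap_id)
    have [measurable]: "(\<lambda>v::real^'n. \<chi> i. v $ Transposition.transpose m n i) \<in> borel_measurable borel"
      by (intro borel_measurable_vec_lambda) simp
    show "P ?S" unfolding P_def S d
      by (subst lborel_transpose_coordinates[of m n]) (auto simp: nn_integral_distr)
  next
    fix m n :: 'n assume 5: "m \<noteq> n"
    let ?S = "(\<chi> i j. of_bool (i = m \<and> j = n \<or> i = j)) :: real^'n^'n"
    have S: "?S *v v = v + axis m (v $ n)" for v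
    proof -
      have "(\<Sum>j\<in>UNIV. of_bool (i = m \<and> j = n \<or> i = j) * v $ j)
          = (\<Sum>j\<in>UNIV. (if j = i then v $ j else 0) + (if j = n then if i = m then v $ j else 0 else 0))" for i
        using 5 by (intro sum.cong) auto
      then have "(\<Sum>j\<in>UNIV. of_bool (i = m \<and> j = n \<or> i = j) * v $ j) = v $ i + (if i = m then v $ n else 0)" for i
        by (simp add: sum.distrib)
      then show ?thesis by (simp add: matrix_vector_mult_def vec_eq_iff axis_def)
    qed
    have "?S = (\<chi> k. if k = m then row m (mat 1) + 1 *s row n (mat 1) else row k (mat 1))"
      using 5 by (auto simp: vec_eq_iff row_def mat_def)
    then have d: "det ?S = 1"
      using det_row_operation[OF 5, of "mat 1 :: real^'n^'n" 1] by simp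
    show "P ?S" unfolding P_def S d using 5
      by (auto simp: nn_integral_lborel_shear)
  qed
  with assms show ?thesis unfolding P_def by blast
qed

section \<open>Gaussian integrals with a linear term\<close>

lemma inner_matrix_vector_transpose:
  fixes A :: "real^'n^'m"
  shows "(A *v x) \<bullet> y = x \<bullet> (transpose A *v y)"
  by (metis dot_lmul_matrix inner_commute transpose_matrix_vector transpose_transpose)

text \<open>Gram--Schmidt for the inner product \<open>x \<bullet> P y\<close>: as long as fewer than \<open>n\<close> vectors have been
  found, the vectors \<open>P a\<^sub>i\<close> do not span, so that some \<open>u \<noteq> 0\<close> is orthogonal to all of them. The
  columns of \<open>A\<close> are the resulting orthonormal basis. This replaces the diagonalisation of \<open>P\<close> or a
  square root of it.\<close>

lemma posdef_congruent_identity: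
  fixes P :: "real^'n^'n"
  assumes sym: "transpose P = P" and pos: "\<And>v. v \<noteq> 0 \<Longrightarrow> v \<bullet> (P *v v) > 0"
  obtains A :: "real^'n^'n" where "transpose A ** P ** A = mat 1"
proof -
  have symP: "x \<bullet> (P *v y) = y \<bullet> (P *v x)" for x y
    using inner_matrix_vector_transpose[of P y x] sym by (simp add: inner_commute)
  have "\<exists>a. \<forall>i\<in>S. \<forall>j\<in>S. a i \<bullet> (P *v a j) = of_bool (i = j)" for S :: "'n set"
  proof (induction S rule: finite_induct[OF finite])
    case 1
    then show ?case by simp
  next
    case (2 k S)
    then obtain a where a: "\<And>i j. i \<in> S \<Longrightarrow> j \<in> S \<Longrightarrow> a i \<bullet> (P *v a j) = of_bool (i = j)"
      by blast
    have "dim ((\<lambda>i. P *v a i) ` S) \<le> card S"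
      by (meson card_image_le dim_le_card' finite finite_imageI le_trans)
    also have "\<dots> < DIM(real^'n)"
      using 2 by (auto intro!: psubset_card_mono)
    finally obtain u where u0: "u \<noteq> 0" and u: "\<And>i. i \<in> S \<Longrightarrow> u \<bullet> (P *v a i) = 0"
      by (rule orthogonal_to_subspace_exists) (auto simp: orthogonal_def span_base)
    define w where "w = (1 / sqrt (u \<bullet> (P *v u))) *\<^sub>R u"
    have ww: "w \<bullet> (P *v w) = 1"
      using pos[OF u0] by (simp add: w_def matrix_vector_mult_scaleR)
    have wa: "w \<bullet> (P *v a i) = 0" if "i \<in> S" for i
      using u[OF that] by (simp add: w_def)
    have "\<forall>i\<in>insert k S. \<forall>j\<in>insert k S. (a(k := w)) i \<bullet> (P *v (a(k := w)) j) = of_bool (i = j)"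
      using 2 ww wa a symP by auto
    then show ?case by blast
  qed
  from this[of UNIV] obtain a :: "'n \<Rightarrow> real^'n"
    where a: "\<And>i j. a i \<bullet> (P *v a j) = of_bool (i = j)" by auto
  define A where "A = (\<chi> r i. a i $ r)"
  have "(transpose A ** (P ** A)) $ i $ j = a i \<bullet> (P *v a j)" for i j
    by (simp add: A_def transpose_def matrix_matrix_mult_def matrix_vector_mult_def inner_vec_def)
  then have "transpose A ** P ** A = mat 1"
    by (simp add: vec_eq_iff a mat_def matrix_mul_assoc)
  then show ?thesis by (rule that)
qed

lemma nn_integral_std_gaussian:
  "(\<integral>\<^sup>+y. ennreal (exp (- (y \<bullet> y) / 2)) \<partial>(lborel :: (real^'n) measure)) = ennreal (sqrt (2 * pi) ^ CARD('n))"
proof -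
  have 1: "(\<integral>\<^sup>+x. ennreal (exp (- x\<^sup>2 / 2)) \<partial>lborel) = ennreal (sqrt (2 * pi))"
  proof -
    have "(\<integral>\<^sup>+x. ennreal (exp (- x\<^sup>2 / 2)) \<partial>lborel)
        = (\<integral>\<^sup>+x. ennreal (sqrt (2 * pi)) * ennreal (std_normal_density x) \<partial>lborel)"
      by (intro nn_integral_cong) (simp add: std_normal_density_def ennreal_mult[symmetric])
    also have "\<dots> = ennreal (sqrt (2 * pi)) * ennreal (\<integral>x. std_normal_density x \<partial>lborel)"
      by (simp add: nn_integral_cmult nn_integral_eq_integral del: integral_normal_density)
    finally show ?thesis by simp
  qed
  have "(\<integral>\<^sup>+y. ennreal (exp (- (y \<bullet> y) / 2)) \<partial>(lborel :: (real^'n) measure))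
      = (\<integral>\<^sup>+y. (\<Prod>b\<in>Basis. ennreal (exp (- (y \<bullet> b)\<^sup>2 / 2))) \<partial>(lborel :: (real^'n) measure))"
  proof (rule nn_integral_cong)
    fix y :: "real^'n"
    have "- (y \<bullet> y) / 2 = (\<Sum>b\<in>Basis. - (y \<bullet> b)\<^sup>2 / 2)"
      by (subst euclidean_inner) (simp add: sum_divide_distrib sum_negf power2_eq_square)
    then show "ennreal (exp (- (y \<bullet> y) / 2)) = (\<Prod>b\<in>Basis. ennreal (exp (- (y \<bullet> b)\<^sup>2 / 2)))"
      by (simp only: exp_sum finite_Basis) (simp add: prod_ennreal)
  qed
  also have "\<dots> = (\<Prod>b\<in>(Basis :: (real^'n) set). \<integral>\<^sup>+x. ennreal (exp (- x\<^sup>2 / 2)) \<partial>lborel)"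
    by (rule nn_integral_lborel_prod) auto
  also have "\<dots> = ennreal (sqrt (2 * pi) ^ CARD('n))"
    unfolding 1 by (simp add: ennreal_power)
  finally show ?thesis .
qed

text \<open>Completing the square around \<open>c\<close> and substituting \<open>v = c + A y\<close>, where \<open>A\<close> carries \<open>P\<close> to the
  identity, leaves the standard Gaussian integral. The Jacobian is read off from
  \<open>(det A)\<^sup>2 det P = 1\<close>, which also yields the sign of \<open>det P\<close>. Writing the linear term as \<open>c \<bullet> P v\<close>
  avoids the inverse of \<open>P\<close>.\<close>

lemma
  fixes P :: "real^'n^'n"
  assumes sym: "transpose P = P" and pos: "\<And>v. v \<noteq> 0 \<Longrightarrow> v \<bullet> (P *v v) > 0"
  shows det_posdef: "det P > 0"
    and nn_integral_gaussian: "(\<integral>\<^sup>+v. ennreal (exp (c \<bullet> (P *v v) - v \<bullet> (P *v v) / 2)) \<partial>lborel)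
      = ennreal (sqrt ((2 * pi) ^ CARD('n) / det P) * exp (c \<bullet> (P *v c) / 2))"
proof -
  obtain A :: "real^'n^'n" where A: "transpose A ** P ** A = mat 1"
    by (rule posdef_congruent_identity[OF sym pos])
  have "det (transpose A ** P ** A) = 1" by (simp add: A)
  then have d: "(det A)\<^sup>2 * det P = 1" by (simp add: det_mul power2_eq_square mult_ac)
  then have "det P \<noteq> 0" "det A \<noteq> 0" by auto
  with d show dP: "det P > 0"
    by (smt (verit) mult_nonneg_nonpos zero_le_power2)
  have dA: "\<bar>det A\<bar> = sqrt (1 / det P)"
    using d dP by (intro real_sqrt_unique[symmetric]) (simp_all add: nonzero_eq_divide_eq)
  have AP: "(A *v y) \<bullet> (P *v (A *v y)) = y \<bullet> y" for y
  proof -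
    have "(A *v y) \<bullet> (P *v (A *v y)) = y \<bullet> (transpose A *v (P *v (A *v y)))"
      by (rule inner_matrix_vector_transpose)
    also have "transpose A *v (P *v (A *v y)) = (transpose A ** P ** A) *v y"
      by (simp only: matrix_vector_mul_assoc matrix_mul_assoc)
    finally show ?thesis by (simp add: A)
  qed
  have symP: "x \<bullet> (P *v y) = y \<bullet> (P *v x)" for x y
    using inner_matrix_vector_transpose[of P y x] sym by (simp add: inner_commute)
  define q where "q v = exp (c \<bullet> (P *v v) - v \<bullet> (P *v v) / 2)" for v
  have q: "q (c + A *v y) = exp (c \<bullet> (P *v c) / 2) * exp (- (y \<bullet> y) / 2)" for y
    unfolding q_def 
    by (simp add: matrix_vector_right_distrib inner_add_left inner_add_right AP symP[of "A *v y" c] 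
        flip: exp_add) (simp add: field_simps)
  have [measurable]: "q \<in> borel_measurable borel"
    unfolding q_def by measurable
  have "(\<integral>\<^sup>+v. ennreal (q v) \<partial>lborel) = (\<integral>\<^sup>+v. ennreal (q (c + v)) \<partial>lborel)"
    by (subst (1) lborel_distr_plus[of c, symmetric]) (simp add: nn_integral_distr)
  also have "\<dots> = ennreal \<bar>det A\<bar> * (\<integral>\<^sup>+y. ennreal (q (c + A *v y)) \<partial>lborel)"
    by (rule nn_integral_lborel_linear) (use \<open>det A \<noteq> 0\<close> in auto)
  also have "(\<integral>\<^sup>+y. ennreal (q (c + A *v y)) \<partial>lborel)
      = ennreal (exp (c \<bullet> (P *v c) / 2)) * ennreal (sqrt (2 * pi) ^ CARD('n))"
    unfolding nn_integral_std_gaussian[symmetric] by (simp add: q ennreal_mult nn_integral_cmult)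
  also have "ennreal \<bar>det A\<bar> * \<dots> = ennreal (sqrt ((2 * pi) ^ CARD('n) / det P) * exp (c \<bullet> (P *v c) / 2))"
  proof -
    have eq: "\<bar>det A\<bar> * (sqrt (2 * pi) ^ CARD('n)) = sqrt ((2 * pi) ^ CARD('n) / det P)"
      by (simp add: dA real_sqrt_divide flip: real_sqrt_power)
    show ?thesis unfolding eq[symmetric] by (simp add: ennreal_mult mult_ac)
  qed
  finally show "(\<integral>\<^sup>+v. ennreal (exp (c \<bullet> (P *v v) - v \<bullet> (P *v v) / 2)) \<partial>lborel)
      = ennreal (sqrt ((2 * pi) ^ CARD('n) / det P) * exp (c \<bullet> (P *v c) / 2))"
    by (simp add: q_def)
qed

lemma det_scaleR: "det (r *\<^sub>R (M :: real^'n^'n)) = r ^ CARD('n) * det M"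
proof -
  have "r *\<^sub>R M = matrix ((*\<^sub>R) r) ** M"
    by (simp add: vec_eq_iff matrix_matrix_mult_def matrix_def axis_def if_distrib[of "\<lambda>x. x * _"]
        if_distrib[of "\<lambda>x. _ * x"] cong: if_cong)
  then show ?thesis by (simp add: det_mul)
qed

section \<open>Spin configurations\<close>

definition spins :: "(real^'n) set" where
  "spins = {b. \<forall>i. b $ i \<in> {- 1, 1}}"

lemma spins_eq_image: "spins = vec_lambda ` Pi\<^sub>E UNIV (\<lambda>_. {- 1, 1})"
proof -
  have "b \<in> vec_lambda ` Pi\<^sub>E UNIV (\<lambda>_. {- 1, 1})" if "b \<in> spins" for b :: "real^'n"
    using that by (intro image_eqI[of _ _ "vec_nth b"]) (auto simp: spins_def)
  then show ?thesis by (auto simp: spins_def PiE_iff)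
qed

lemma inj_vec_lambda: "inj_on vec_lambda S"
  by (auto simp: inj_on_def vec_lambda_inject)

lemma finite_spins: "finite spins"
  unfolding spins_eq_image by (intro finite_imageI finite_PiE) auto

lemma card_spins: "card (spins :: (real^'n) set) = 2 ^ CARD('n)"
  unfolding spins_eq_image by (simp add: card_image inj_vec_lambda card_PiE numeral_2_eq_2)

lemma spins_nonempty: "spins \<noteq> {}"
  using card_spins by (metis card.empty power_not_zero zero_neq_numeral)

lemma uniform_spins_eq: "(uniform_spins :: (real^'n) pmf) = pmf_of_set spins"
proof -
  have "PiE_dflt UNIV 0 (\<lambda>_. {- 1, 1}) = Pi\<^sub>E UNIV (\<lambda>_::'n. {- 1, 1 :: real})"
    by (auto simp: PiE_dflt_def PiE_iff)
  then have "Pi_pmf (UNIV :: 'n set) 0 (\<lambda>_. pmf_of_set {- 1, 1 :: real}) = pmf_of_set (Pi\<^sub>E UNIV (\<lambda>_. {- 1, 1}))"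
    by (subst Pi_pmf_of_set) auto
  then show ?thesis
    unfolding uniform_spins_def spins_eq_image
    by (simp add: map_pmf_of_set_inj inj_vec_lambda finite_PiE PiE_eq_empty_iff)
qed

lemma partition_function_eq:
  fixes C :: "real^'n^'n"
  shows "partition_function \<beta> C = (\<Sum>b\<in>spins. boltzmann_weight \<beta> C b) / 2 ^ CARD('n)"
  unfolding partition_function_def uniform_spins_eq
  by (simp add: integral_pmf_of_set finite_spins spins_nonempty card_spins)

lemma partition_function_pos: "partition_function \<beta> C > 0"
  unfolding partition_function_eq
  by (intro divide_pos_pos sum_pos) (auto simp: finite_spins spins_nonempty boltzmann_weight_def)

text \<open>Each factor is \<open>(e\<^sup>v + e\<^sup>-\<^sup>v) / 2\<close>, a mean over the two spin values; expanding the product gives the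
  mean over all configurations. The field law is thus a mixture of shifted Gaussians.\<close>

lemma prod_cosh_eq_sum_spins:
  fixes v :: "real^'n"
  shows "(\<Prod>i\<in>UNIV. cosh (v $ i)) = (\<Sum>b\<in>spins. exp (b \<bullet> v)) / 2 ^ CARD('n)"
proof -
  have "(\<Prod>i\<in>UNIV. cosh (v $ i)) = (\<Prod>i\<in>UNIV. (\<Sum>s\<in>{- 1, 1}. exp (s * v $ i)) / 2)"
    by (intro prod.cong) (auto simp: cosh_field_def)
  also have "\<dots> = (\<Prod>i\<in>UNIV. \<Sum>s\<in>{- 1, 1}. exp (s * v $ i)) / 2 ^ CARD('n)"
    by (simp add: prod_dividef)
  also have "(\<Prod>i\<in>UNIV. \<Sum>s\<in>{- 1, 1}. exp (s * v $ i))
      = (\<Sum>b\<in>Pi\<^sub>E UNIV (\<lambda>_. {- 1, 1}). \<Prod>i\<in>UNIV. exp (b i * v $ i))"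
    by (rule prod_sum_PiE) auto
  also have "\<dots> = (\<Sum>b\<in>spins. exp (b \<bullet> v))"
    unfolding spins_eq_image
    by (subst sum.reindex[OF inj_vec_lambda]) (simp add: inner_vec_def exp_sum)
  finally show ?thesis .
qed

section \<open>The exponential moments and the total mass of the field law\<close>

lemma
  fixes C :: "real^'n^'n"
  assumes "invertible C"
  shows matrix_inv_right: "C ** matrix_inv C = mat 1"
    and matrix_inv_left: "matrix_inv C ** C = mat 1"
  using someI_ex[OF assms[unfolded invertible_def]] by (simp_all add: matrix_inv_def)

lemma transpose_matrix_inv:
  fixes C :: "real^'n^'n"
  assumes "invertible C" "transpose C = C"
  shows "transpose (matrix_inv C) = matrix_inv C"
proof -
  have "transpose (matrix_inv C) ** C = mat 1"
    by (metis assms matrix_inv_right matrix_transpose_mul transpose_mat)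
  then show ?thesis
    by (metis assms(1) matrix_inv_right matrix_mul_assoc matrix_mul_lid matrix_mul_rid)
qed

text \<open>The Hubbard--Stratonovich transformation: the Gaussian field with covariance \<open>\<beta> C\<close> has
  \<open>e\<^bsup>b \<bullet> \<beta> C b / 2\<^esup>\<close> as its exponential moment in direction \<open>b\<close>, which is the Boltzmann weight of \<open>b\<close>. It
  linearises the pair interaction in the spins.\<close>

lemma nn_integral_gaussian_density_exp:
  fixes C :: "real^'n^'n"
  assumes C: "invertible C" "transpose C = C" and \<beta>: "\<beta> > 0"
    and pos: "\<And>v. v \<noteq> 0 \<Longrightarrow> v \<bullet> (matrix_inv C *v v) > 0"
  shows "det C > 0"
    and "(\<integral>\<^sup>+v. ennreal (gaussian_density \<beta> C v * exp (b \<bullet> v)) \<partial>lborel) = ennreal (boltzmann_weight \<beta> C b)"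
proof -
  define P where "P = inverse \<beta> *\<^sub>R matrix_inv C"
  define c where "c = \<beta> *\<^sub>R (C *v b)"
  have Pv: "P *v v = inverse \<beta> *\<^sub>R (matrix_inv C *v v)" for v
    by (simp add: P_def scaleR_matrix_vector_assoc)
  have symP: "transpose P = P"
    by (simp add: P_def transpose_scalar transpose_matrix_inv C)
  have posP: "v \<bullet> (P *v v) > 0" if "v \<noteq> 0" for v
    using pos[OF that] \<beta> by (simp add: Pv)
  have inv: "det (matrix_inv C) * det C = 1"
    by (metis C(1) det_I det_mul matrix_inv_left)
  have detP: "det P = inverse \<beta> ^ CARD('n) / det C"
  proof -
    have "det C \<noteq> 0" using inv by auto
    with inv have "det (matrix_inv C) = 1 / det C" by (simp add: nonzero_eq_divide_eq)
    then show ?thesis by (simp add: P_def det_scaleR)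
  qed
  with det_posdef[OF symP posP] \<beta> show dC: "det C > 0"
    by (simp add: zero_less_divide_iff)
  have Pc: "P *v c = b"
  proof -
    have "matrix_inv C *v (C *v b) = b"
      by (simp add: matrix_vector_mul_assoc matrix_inv_left C)
    then show ?thesis using \<beta> by (simp add: Pv c_def matrix_vector_mult_scaleR)
  qed
  have cP: "c \<bullet> (P *v v) = b \<bullet> v" for v
    using inner_matrix_vector_transpose[of P c v] by (simp add: symP Pc del: transpose_matrix_vector)
  have "sqrt ((2 * pi) ^ CARD('n) / det P) = sqrt (det ((2 * pi * \<beta>) *\<^sub>R C))"
    using \<beta> dC by (simp add: detP det_scaleR power_mult_distrib field_simps)
  moreover have "sqrt (det ((2 * pi * \<beta>) *\<^sub>R C)) > 0"
    using \<beta> dC by (simp add: det_scaleR)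
  ultimately obtain s where s: "s > 0" "sqrt (det ((2 * pi * \<beta>) *\<^sub>R C)) = s" "sqrt ((2 * pi) ^ CARD('n) / det P) = s"
    by metis
  have "(\<integral>\<^sup>+v. ennreal (gaussian_density \<beta> C v * exp (b \<bullet> v)) \<partial>lborel)
      = (\<integral>\<^sup>+v. ennreal (1 / s) * ennreal (exp (c \<bullet> (P *v v) - v \<bullet> (P *v v) / 2)) \<partial>lborel)"
  proof (rule nn_integral_cong)
    fix v :: "real^'n"
    have "gaussian_density \<beta> C v * exp (b \<bullet> v) = 1 / s * exp (c \<bullet> (P *v v) - v \<bullet> (P *v v) / 2)"
      unfolding gaussian_density_def s(2) cP unfolding Pv by (simp add: exp_diff exp_minus field_simps)
    then show "ennreal (gaussian_density \<beta> C v * exp (b \<bullet> v))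
        = ennreal (1 / s) * ennreal (exp (c \<bullet> (P *v v) - v \<bullet> (P *v v) / 2))"
      using s(1) by (simp add: ennreal_mult[symmetric])
  qed
  also have "\<dots> = ennreal (1 / s) * ennreal (s * exp (c \<bullet> (P *v c) / 2))"
    using nn_integral_gaussian[OF symP posP, of c] s(3) 
    by (subst nn_integral_cmult) auto
  also have "\<dots> = ennreal (boltzmann_weight \<beta> C b)"
  proof -
    have "c \<bullet> (P *v c) = b \<bullet> ((\<beta> *\<^sub>R C) *v b)"
      unfolding Pc by (simp add: c_def inner_commute flip: scaleR_matrix_vector_assoc)
    then show ?thesis
      using s(1) by (simp add: ennreal_mult[symmetric] boltzmann_weight_def)
  qed
  finally show "(\<integral>\<^sup>+v. ennreal (gaussian_density \<beta> C v * exp (b \<bullet> v)) \<partial>lborel) = ennreal (boltzmann_weight \<beta> C b)" .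
qed

lemma posdef_matrix_inv:
  fixes C :: "real^'n^'n"
  assumes "invertible C" "transpose C = C" "\<forall>v. v \<noteq> 0 \<longrightarrow> v \<bullet> (C *v v) > 0" "v \<noteq> 0"
  shows "v \<bullet> (matrix_inv C *v v) > 0"
proof -
  let ?w = "matrix_inv C *v v"
  have v: "v = C *v ?w"
    by (simp add: matrix_vector_mul_assoc matrix_inv_right assms)
  then have "?w \<noteq> 0" using assms by auto
  then have "?w \<bullet> (C *v ?w) > 0" using assms by blast
  then show ?thesis using v by (metis inner_commute)
qed

lemma borel_measurable_gaussian_density [measurable]: "gaussian_density \<beta> C \<in> borel_measurable borel"
  unfolding gaussian_density_def[abs_def] by measurable

lemma gaussian_density_nonneg: "det C > 0 \<Longrightarrow> \<beta> > 0 \<Longrightarrow> gaussian_density \<beta> C v \<ge> 0"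
  by (simp add: gaussian_density_def det_scaleR)

lemma emeasure_field_law:
  fixes C :: "real^'n^'n"
  shows "emeasure (field_law \<beta> C) (space (field_law \<beta> C))
    = (\<integral>\<^sup>+v. ennreal (1 / partition_function \<beta> C * gaussian_density \<beta> C v * (\<Prod>i\<in>UNIV. cosh (v $ i))) \<partial>lborel)"
proof -
  have [measurable]: "(\<lambda>v :: real^'n. cosh (v $ i)) \<in> borel_measurable borel" for i
    by (simp add: cosh_field_def)
  show ?thesis unfolding field_law_def by (subst emeasure_density) (auto simp: space_density)
qed

text \<open>After the expansion of the \<open>cosh\<close> product, the total mass is the mean of the Boltzmann
  weights divided by the partition function.\<close>

lemma prob_space_field_law:
  fixes C :: "real^'n^'n"
  assumes C: "invertible C" "transpose C = C" and \<beta>: "\<beta> > 0"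
    and pos: "\<And>v. v \<noteq> 0 \<Longrightarrow> v \<bullet> (matrix_inv C *v v) > 0"
  shows "prob_space (field_law \<beta> C)"
proof
  note dC = nn_integral_gaussian_density_exp(1)[OF C \<beta> pos]
  define Z where "Z = partition_function \<beta> C"
  have Z: "Z > 0" by (simp add: Z_def partition_function_pos)
  have nonneg: "gaussian_density \<beta> C v \<ge> 0" for v
    using dC \<beta> by (rule gaussian_density_nonneg)
  have "emeasure (field_law \<beta> C) (space (field_law \<beta> C))
      = (\<integral>\<^sup>+v. ennreal (1 / Z * gaussian_density \<beta> C v * (\<Prod>i\<in>UNIV. cosh (v $ i))) \<partial>lborel)"
    by (simp add: emeasure_field_law Z_def)
  also have "\<dots> = (\<integral>\<^sup>+v. ennreal (1 / (Z * 2 ^ CARD('n))) * (\<Sum>b\<in>spins. ennreal (gaussian_density \<beta> C v * exp (b \<bullet> v))) \<partial>lborel)"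
  proof (rule nn_integral_cong)
    fix v :: "real^'n"
    have "1 / Z * gaussian_density \<beta> C v * (\<Prod>i\<in>UNIV. cosh (v $ i))
        = 1 / (Z * 2 ^ CARD('n)) * (\<Sum>b\<in>spins. gaussian_density \<beta> C v * exp (b \<bullet> v))"
      by (simp add: prod_cosh_eq_sum_spins flip: sum_distrib_left)
    also have "ennreal \<dots> = ennreal (1 / (Z * 2 ^ CARD('n))) * (\<Sum>b\<in>spins. ennreal (gaussian_density \<beta> C v * exp (b \<bullet> v)))"
      using Z nonneg by (subst ennreal_mult) (auto intro!: sum_nonneg)
    finally show "ennreal (1 / Z * gaussian_density \<beta> C v * (\<Prod>i\<in>UNIV. cosh (v $ i)))
        = ennreal (1 / (Z * 2 ^ CARD('n))) * (\<Sum>b\<in>spins. ennreal (gaussian_density \<beta> C v * exp (b \<bullet> v)))" .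
  qed
  also have "\<dots> = ennreal (1 / (Z * 2 ^ CARD('n))) * (\<Sum>b\<in>spins. ennreal (boltzmann_weight \<beta> C b))"
    by (simp add: nn_integral_cmult nn_integral_sum nn_integral_gaussian_density_exp(2)[OF C \<beta> pos])
  also have "(\<Sum>b\<in>spins. ennreal (boltzmann_weight \<beta> C b)) = ennreal (Z * 2 ^ CARD('n))"
    by (simp add: boltzmann_weight_def Z_def partition_function_eq)
  also have "ennreal (1 / (Z * 2 ^ CARD('n))) * \<dots> = 1"
    using Z by (simp add: ennreal_mult[symmetric])
  finally show "emeasure (field_law \<beta> C) (space (field_law \<beta> C)) = 1" .
qed

section \<open>A field law of total mass 1 has a positive definite coupling\<close>

text \<open>If \<open>u\<close> is isotropic, the derivative of the quadratic form at \<open>u\<close> in the direction \<open>x = P u\<close>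
  is \<open>2 (x \<bullet> x) > 0\<close>. A small step against \<open>x\<close> therefore makes the form negative.\<close>

lemma negative_direction:
  fixes P :: "real^'n^'n"
  assumes sym: "transpose P = P" and inj: "\<And>v. v \<noteq> 0 \<Longrightarrow> P *v v \<noteq> 0"
    and u: "u \<noteq> 0" "u \<bullet> (P *v u) \<le> 0"
  obtains w where "w \<bullet> (P *v w) < 0"
proof (cases "u \<bullet> (P *v u) = 0")
  case False
  with u have "u \<bullet> (P *v u) < 0" by linarith
  then show ?thesis by (rule that)
next
  case True
  define x where "x = P *v u"
  define q where "q = x \<bullet> (P *v x)"
  \<comment> \<open>small enough that the quadratic term is dominated: \<open>\<bar>t q\<bar> \<le> x \<bullet> x\<close>\<close>
  define t where "t = - (x \<bullet> x) / (\<bar>q\<bar> + 1)"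
  have Pu: "P *v u = x" by (simp add: x_def)
  have ux: "u \<bullet> x = 0" using True by (simp add: x_def)
  have x: "x \<bullet> x > 0" using inj u by (simp add: x_def)
  have xu: "u \<bullet> (P *v x) = x \<bullet> x"
    using inner_matrix_vector_transpose[of P u x] by (simp add: sym x_def del: transpose_matrix_vector)
  have "(u + t *\<^sub>R x) \<bullet> (P *v (u + t *\<^sub>R x)) = 2 * t * (x \<bullet> x) + t * t * q"
    using Pu by (simp add: matrix_vector_right_distrib inner_add_left inner_add_right
        matrix_vector_mult_scaleR ux xu flip: q_def) (simp add: algebra_simps)
  also have "\<dots> = t * (2 * (x \<bullet> x) + t * q)" by (simp add: algebra_simps)
  also have "\<dots> < 0"
  proof -
    have "(x \<bullet> x) * (\<bar>q\<bar> / (\<bar>q\<bar> + 1)) \<le> (x \<bullet> x) * 1"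
      using x by (intro mult_left_mono) auto
    moreover have "\<bar>t * q\<bar> = (x \<bullet> x) * (\<bar>q\<bar> / (\<bar>q\<bar> + 1))"
      using x by (simp add: t_def abs_mult)
    ultimately have "2 * (x \<bullet> x) + t * q > 0" using x by linarith
    moreover have "t < 0" using x by (simp add: t_def divide_neg_pos)
    ultimately show ?thesis by (rule mult_neg_pos[rotated])
  qed
  finally show ?thesis by (rule that)
qed

text \<open>Doubling maps \<open>K\<close> to itself but multiplies its volume by \<open>2\<^sup>n\<close> with \<open>n \<ge> 1\<close>, so the volume is
  zero or infinite; it is not zero for a nonempty open set.\<close>

lemma emeasure_lborel_open_cone:
  fixes K :: "(real^'n) set"
  assumes K: "open K" "K \<noteq> {}" and cone: "\<And>v. 2 *\<^sub>R v \<in> K \<longleftrightarrow> v \<in> K"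
  shows "emeasure lborel K = \<infinity>"
proof (rule ccontr)
  assume fin: "emeasure lborel K \<noteq> \<infinity>"
  have [measurable]: "K \<in> sets borel" using K by simp
  have "emeasure lborel K = (\<integral>\<^sup>+v. indicator K v \<partial>lborel)" by simp
  also have "\<dots> = ennreal (\<Prod>i\<in>(UNIV::'n set). \<bar>2\<bar>) * (\<integral>\<^sup>+v. indicator K (\<chi> i. 2 * v $ i) \<partial>lborel)"
    by (rule nn_integral_lborel_diagonal) auto
  also have "(\<lambda>v. indicator K (\<chi> i. 2 * v $ i)) = (indicator K :: _ \<Rightarrow> ennreal)"
  proof
    fix v :: "real^'n"
    have "(\<chi> i. 2 * v $ i) = 2 *\<^sub>R v" by (simp add: vec_eq_iff)
    then show "indicator K (\<chi> i. 2 * v $ i) = (indicator K v :: ennreal)"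
      using cone[of v] by (simp add: indicator_def)
  qed
  finally have eq: "emeasure lborel K = ennreal (2 ^ CARD('n)) * emeasure lborel K" by simp
  obtain m where m: "emeasure lborel K = ennreal m" "m \<ge> 0"
    using fin by (cases "emeasure lborel K") auto
  have "m = 2 ^ CARD('n) * m"
    using eq m by (simp add: ennreal_mult[symmetric])
  moreover have "(2 :: real) ^ CARD('n) > 1"
    by (intro one_less_power) simp_all
  ultimately have "m = 0" by auto
  with m have "K \<in> null_sets lebesgue"
    by (auto intro!: null_sets_completionI simp: null_sets_def)
  then show False
    using open_not_negligible[OF K] by (simp add: negligible_iff_null_sets)
qed

text \<open>If the determinant were negative, the root in the normalisation and hence the density
  would be negative, which the measure truncates to zero. If the form took a value \<open>\<le> 0\<close> away from
  the origin, it would be negative on an open cone. There the exponential is at least 1, so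
  the density is at least a positive constant on a set of infinite volume. Neither is compatible with
  total mass 1.\<close>

lemma posdef_of_prob_space_field_law:
  fixes C :: "real^'n^'n"
  assumes C: "invertible C" "transpose C = C" and \<beta>: "\<beta> > 0"
    and prob: "prob_space (field_law \<beta> C)" and u: "u \<noteq> 0"
  shows "u \<bullet> (matrix_inv C *v u) > 0"
proof (rule ccontr)
  assume "\<not> u \<bullet> (matrix_inv C *v u) > 0"
  moreover have "matrix_inv C *v v \<noteq> 0" if "v \<noteq> 0" for v
    using that by (metis C(1) matrix_inv_right matrix_vector_mul_assoc matrix_vector_mul_lid matrix_vector_mult_0_right)
  ultimately obtain w where w: "w \<bullet> (matrix_inv C *v w) < 0"
    using negative_direction[OF transpose_matrix_inv[OF C] _ u] by (metis linorder_not_less)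
  define Z where "Z = partition_function \<beta> C"
  define s where "s = sqrt (det ((2 * pi * \<beta>) *\<^sub>R C))"
  define K where "K = {v. v \<bullet> (matrix_inv C *v v) < 0}"
  have Z: "Z > 0" by (simp add: Z_def partition_function_pos)
  have "(\<integral>\<^sup>+v. ennreal (1 / Z * gaussian_density \<beta> C v * (\<Prod>i\<in>UNIV. cosh (v $ i))) \<partial>lborel)
      = emeasure (field_law \<beta> C) (space (field_law \<beta> C))"
    by (simp add: emeasure_field_law Z_def)
  also have "\<dots> = 1" by (rule prob_space.emeasure_space_1[OF prob])
  finally have total: "(\<integral>\<^sup>+v. ennreal (1 / Z * gaussian_density \<beta> C v * (\<Prod>i\<in>UNIV. cosh (v $ i))) \<partial>lborel) = 1" .
  have s: "s > 0"
  proof (rule ccontr)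
    \<comment> \<open>for \<open>s = 0\<close> the density vanishes because division by zero yields zero\<close>
    assume "\<not> s > 0"
    then have "1 / Z * gaussian_density \<beta> C v * (\<Prod>i\<in>UNIV. cosh (v $ i)) \<le> 0" for v
      using Z by (auto simp: gaussian_density_def s_def[symmetric] intro!: mult_nonpos_nonneg mult_nonneg_nonpos prod_nonneg divide_nonneg_nonpos cosh_real_nonneg mult_nonneg_nonneg)
    then show False using total by (simp add: ennreal_neg)
  qed
  have "open K"
    unfolding K_def by (intro open_Collect_less continuous_intros linear_continuous_on) (simp_all add: linear_linear)
  moreover have "2 *\<^sub>R v \<in> K \<longleftrightarrow> v \<in> K" for v
    by (simp add: K_def matrix_vector_mult_scaleR)
  ultimately have inf: "emeasure lborel K = \<infinity>"
    using w by (intro emeasure_lborel_open_cone) (auto simp: K_def)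
  have "ennreal (1 / (Z * s)) * emeasure lborel K = (\<integral>\<^sup>+v. ennreal (1 / (Z * s)) * indicator K v \<partial>lborel)"
    using \<open>open K\<close> by (simp add: nn_integral_cmult)
  also have "\<dots> \<le> (\<integral>\<^sup>+v. ennreal (1 / Z * gaussian_density \<beta> C v * (\<Prod>i\<in>UNIV. cosh (v $ i))) \<partial>lborel)"
  proof (rule nn_integral_mono)
    fix v :: "real^'n"
    have "1 / (Z * s) \<le> 1 / Z * gaussian_density \<beta> C v * (\<Prod>i\<in>UNIV. cosh (v $ i))" if "v \<in> K"
    proof -
      have "0 \<le> - (inverse \<beta> / 2) * (v \<bullet> (matrix_inv C *v v))"
        using that \<beta> by (intro mult_nonpos_nonpos) (auto simp: K_def)
      then have "1 \<le> exp (- (inverse \<beta> / 2) * (v \<bullet> (matrix_inv C *v v)))" by simp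
      then have "1 / s \<le> gaussian_density \<beta> C v"
        using s unfolding gaussian_density_def s_def[symmetric] by (intro divide_right_mono) auto
      then have "1 / Z * (1 / s) * 1 \<le> 1 / Z * gaussian_density \<beta> C v * (\<Prod>i\<in>UNIV. cosh (v $ i))"
        using Z s by (intro mult_mono prod_ge_1 mult_nonneg_nonneg) (auto simp: cosh_real_ge_1 order_trans[of 0 "1/s"])
      then show ?thesis by simp
    qed
    then show "ennreal (1 / (Z * s)) * indicator K v
        \<le> ennreal (1 / Z * gaussian_density \<beta> C v * (\<Prod>i\<in>UNIV. cosh (v $ i)))"
      by (auto simp: indicator_def intro!: ennreal_leI)
  qed
  finally have "ennreal (1 / (Z * s)) * emeasure lborel K \<le> 1" unfolding total .
  moreover have "ennreal (1 / (Z * s)) * emeasure lborel K = \<infinity>"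
    using Z s by (simp add: inf ennreal_mult_top)
  ultimately show False by (simp add: top_unique)
qed

section \<open>Randomised spins\<close>

lemma logistic_minus: "logistic (- a) = 1 - logistic a"
proof -
  have "exp a + exp (- a) > 0" by (simp add: add_pos_pos)
  then show ?thesis by (simp add: logistic_def field_simps)
qed

lemma logistic_nonneg: "logistic a \<ge> 0"
  by (simp add: logistic_def)

text \<open>The \<open>cosh\<close> factor of the field law is the normalising factor of the conditional spin
  law; their product is the exponential tilt of the field.\<close>

lemma logistic_mult_cosh: 
  assumes "s \<in> {- 1, 1}" 
  shows "logistic (s * a) * cosh a = exp (s * a) / 2"
proof -
  define d where "d = exp a + exp (- a)"
  have d: "d > 0" by (simp add: d_def add_pos_pos)
  have l: "logistic (s * a) = exp (s * a) / d"
    using assms by (auto simp: logistic_def d_def add.commute)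
  have c: "cosh a = d / 2"
    by (simp add: d_def cosh_field_def)
  show ?thesis unfolding l c using d by simp
qed

lemma sets_vimage_borel_subalgebra:
  assumes "V \<in> borel_measurable M"
  shows "subalgebra M (vimage_algebra (space M) V borel)"
  unfolding subalgebra_def using assms
  by (auto simp: sets_vimage_algebra2 measurable_def)

text \<open>The probability of a configuration is the mean of its conditional probability given \<open>V\<close>.
  Conditional independence, applied to the singletons \<open>{b\<^sub>i}\<close>, splits the latter into one factor for
  each vertex. Only the conditional probability of the value 1 is prescribed; that of the value -1
  is its complement, and \<open>1 - logistic a = logistic (- a)\<close> combines the two cases into
  \<open>logistic (b\<^sub>i V\<^sub>i)\<close>.\<close>

lemma prob_randomised_spins_eq:
  fixes b :: "real^'n"
  assumes V: "random_vector M V" and W: "randomised_spins M V W" and b: "b \<in> spins"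
  shows "emeasure M {x \<in> space M. W x = b} = (\<integral>\<^sup>+x. ennreal (\<Prod>i\<in>UNIV. logistic (b $ i * V x $ i)) \<partial>M)"
proof -
  interpret prob_space M using V by (simp add: random_vector_def)
  have [measurable]: "V \<in> borel_measurable M" "W \<in> borel_measurable M"
    using V W by (simp_all add: random_vector_def randomised_spins_def)
  define F where "F = vimage_algebra (space M) V borel"
  interpret finite_measure_subalgebra M F
    by unfold_locales (simp add: F_def sets_vimage_borel_subalgebra)
  have cond: "cond_prob_given M V Q = real_cond_exp M F (indicator {x \<in> space M. Q x})" for Q
    by (simp add: cond_prob_given_def F_def)
  have Wpm: "W x $ i \<in> {- 1, 1}" if "x \<in> space M" for x i
    using W that by (simp add: randomised_spins_def)
  have event [measurable]: "{x \<in> space M. W x $ i = s} \<in> sets M" for i s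
    by measurable
  have int: "integrable M (indicator {x \<in> space M. W x $ i = s} :: _ \<Rightarrow> real)" for i s
    by (intro integrable_real_indicator event) (simp add: less_top[symmetric])
  have up: "AE x in M. cond_prob_given M V (\<lambda>y. W y $ i = 1) x = logistic (V x $ i)" for i
    using W by (simp add: randomised_spins_def)
  have down: "AE x in M. cond_prob_given M V (\<lambda>y. W y $ i = - 1) x = logistic (- (V x $ i))" for i
  proof -
    have "AE x in M. real_cond_exp M F (indicator {x \<in> space M. W x $ i = - 1}) x
        = real_cond_exp M F (\<lambda>x. 1 - indicator {x \<in> space M. W x $ i = 1} x) x"
      by (intro real_cond_exp_cong AE_I2) (use Wpm[of _ i] in \<open>auto simp: indicator_def\<close>)
    moreover have "AE x in M. real_cond_exp M F (\<lambda>x. 1 - indicator {x \<in> space M. W x $ i = 1} x) x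
        = real_cond_exp M F (\<lambda>x. 1) x - real_cond_exp M F (indicator {x \<in> space M. W x $ i = 1}) x"
      by (intro real_cond_exp_diff int) simp
    moreover have "AE x in M. real_cond_exp M F (\<lambda>x. 1) x = 1"
      by (intro real_cond_exp_F_meas) simp_all
    ultimately show ?thesis
      using up[of i] unfolding cond by eventually_elim (simp add: logistic_minus)
  qed
  have single: "AE x in M. cond_prob_given M V (\<lambda>y. W y $ i \<in> {b $ i}) x = logistic (b $ i * V x $ i)" for i
  proof (cases "b $ i = 1")
    case True
    then show ?thesis using up[of i] by simp
  next
    case False
    then have "b $ i = - 1" using b by (auto simp: spins_def)
    then show ?thesis using down[of i] by simp
  qed
  have "AE x in M. cond_prob_given M V (\<lambda>y. \<forall>i. W y $ i \<in> {b $ i}) x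
      = (\<Prod>i\<in>UNIV. cond_prob_given M V (\<lambda>y. W y $ i \<in> {b $ i}) x)"
    using W unfolding randomised_spins_def by (elim conjE allE[of _ "\<lambda>i. {b $ i}"]) simp
  moreover have "AE x in M. \<forall>i. cond_prob_given M V (\<lambda>y. W y $ i \<in> {b $ i}) x = logistic (b $ i * V x $ i)"
    using single by (subst AE_all_countable) auto
  ultimately have prod: "AE x in M. real_cond_exp M F (indicator {x \<in> space M. W x = b}) x
      = (\<Prod>i\<in>UNIV. logistic (b $ i * V x $ i))"
    by eventually_elim (simp add: cond vec_eq_iff)
  have [measurable]: "{x \<in> space M. W x = b} \<in> sets M" by measurable
  have int_b: "integrable M (indicator {x \<in> space M. W x = b} :: _ \<Rightarrow> real)"
    by (intro integrable_real_indicator) (simp_all add: less_top[symmetric])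
  note ce = real_cond_exp_int[OF int_b]
  have meas [measurable]: "(\<lambda>x. \<Prod>i\<in>UNIV. logistic (b $ i * V x $ i)) \<in> borel_measurable M"
    unfolding logistic_def by measurable
  have int_prod: "integrable M (\<lambda>x. \<Prod>i\<in>UNIV. logistic (b $ i * V x $ i))"
    by (rule integrable_cong_AE_imp[OF ce(1) _ _]) (use prod in \<open>auto elim: eventually_mono\<close>)
  have "emeasure M {x \<in> space M. W x = b} = ennreal (\<integral>x. indicator {x \<in> space M. W x = b} x \<partial>M)"
  proof -
    have "{x \<in> space M. W x = b} \<inter> space M = {x \<in> space M. W x = b}" by auto
    then show ?thesis by (simp add: emeasure_eq_measure)
  qed
  also have "\<dots> = ennreal (\<integral>x. real_cond_exp M F (indicator {x \<in> space M. W x = b}) x \<partial>M)"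
    by (simp only: ce(2))
  also have "\<dots> = ennreal (\<integral>x. (\<Prod>i\<in>UNIV. logistic (b $ i * V x $ i)) \<partial>M)"
    using prod by (intro arg_cong[where f=ennreal] integral_cong_AE) auto
  also have "\<dots> = (\<integral>\<^sup>+x. ennreal (\<Prod>i\<in>UNIV. logistic (b $ i * V x $ i)) \<partial>M)"
    by (intro nn_integral_eq_integral[symmetric] int_prod) (simp add: logistic_nonneg prod_nonneg)
  finally show ?thesis .
qed

text \<open>The factors \<open>cosh v\<^sub>i\<close> cancel the denominators of the logistic functions, which leaves
  \<open>2\<^sup>-\<^sup>n\<close> times the exponential moment of the Gaussian field in direction \<open>b\<close>, divided by the
  partition function.\<close>

lemma nn_integral_field_law_logistic:
  fixes C :: "real^'n^'n"
  assumes C: "invertible C" "transpose C = C" and \<beta>: "\<beta> > 0"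
    and pos: "\<And>v. v \<noteq> 0 \<Longrightarrow> v \<bullet> (matrix_inv C *v v) > 0"
    and b: "b \<in> spins"
  shows "(\<integral>\<^sup>+v. ennreal (\<Prod>i\<in>UNIV. logistic (b $ i * v $ i)) \<partial>field_law \<beta> C)
    = ennreal (boltzmann_weight \<beta> C b / partition_function \<beta> C / 2 ^ CARD('n))"
proof -
  note dC = nn_integral_gaussian_density_exp(1)[OF C \<beta> pos]
  define Z where "Z = partition_function \<beta> C"
  have Z: "Z > 0" by (simp add: Z_def partition_function_pos)
  have nonneg: "gaussian_density \<beta> C v \<ge> 0" for v
    using dC \<beta> by (rule gaussian_density_nonneg)
  have [measurable]: "(\<lambda>v :: real^'n. cosh (v $ i)) \<in> borel_measurable borel" for i
    by (simp add: cosh_field_def)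
  have [measurable]: "(\<lambda>v :: real^'n. logistic (b $ i * v $ i)) \<in> borel_measurable borel" for i
    by (simp add: logistic_def)
  have "(\<integral>\<^sup>+v. ennreal (\<Prod>i\<in>UNIV. logistic (b $ i * v $ i)) \<partial>field_law \<beta> C)
      = (\<integral>\<^sup>+v. ennreal (1 / Z * gaussian_density \<beta> C v * (\<Prod>i\<in>UNIV. cosh (v $ i)))
            * ennreal (\<Prod>i\<in>UNIV. logistic (b $ i * v $ i)) \<partial>lborel)"
    unfolding field_law_def Z_def by (rule nn_integral_density) measurable
  also have "\<dots> = (\<integral>\<^sup>+v. ennreal (1 / (Z * 2 ^ CARD('n))) * ennreal (gaussian_density \<beta> C v * exp (b \<bullet> v)) \<partial>lborel)"
  proof (rule nn_integral_cong)
    fix v :: "real^'n"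
    have "(\<Prod>i\<in>UNIV. cosh (v $ i)) * (\<Prod>i\<in>UNIV. logistic (b $ i * v $ i))
        = (\<Prod>i\<in>UNIV. exp (b $ i * v $ i) / 2)"
      using b by (simp add: prod.distrib[symmetric] mult.commute[of "cosh _"] logistic_mult_cosh spins_def)
    also have "\<dots> = exp (b \<bullet> v) / 2 ^ CARD('n)"
      by (simp add: prod_dividef inner_vec_def exp_sum)
    finally have eq: "(\<Prod>i\<in>UNIV. cosh (v $ i)) * (\<Prod>i\<in>UNIV. logistic (b $ i * v $ i)) = exp (b \<bullet> v) / 2 ^ CARD('n)" .
    have "ennreal (1 / Z * gaussian_density \<beta> C v * (\<Prod>i\<in>UNIV. cosh (v $ i)))
            * ennreal (\<Prod>i\<in>UNIV. logistic (b $ i * v $ i))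
        = ennreal (1 / Z * gaussian_density \<beta> C v * ((\<Prod>i\<in>UNIV. cosh (v $ i)) * (\<Prod>i\<in>UNIV. logistic (b $ i * v $ i))))"
      using Z nonneg by (subst ennreal_mult[symmetric])
        (auto intro!: prod_nonneg mult_nonneg_nonneg divide_nonneg_nonneg logistic_nonneg cosh_real_nonneg simp: mult.assoc)
    also have "\<dots> = ennreal (1 / (Z * 2 ^ CARD('n))) * ennreal (gaussian_density \<beta> C v * exp (b \<bullet> v))"
      unfolding eq using Z nonneg by (subst ennreal_mult[symmetric]) auto
    finally show "ennreal (1 / Z * gaussian_density \<beta> C v * (\<Prod>i\<in>UNIV. cosh (v $ i)))
            * ennreal (\<Prod>i\<in>UNIV. logistic (b $ i * v $ i))
        = ennreal (1 / (Z * 2 ^ CARD('n))) * ennreal (gaussian_density \<beta> C v * exp (b \<bullet> v))" .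
  qed
  also have "\<dots> = ennreal (1 / (Z * 2 ^ CARD('n))) * ennreal (boltzmann_weight \<beta> C b)"
    by (simp add: nn_integral_cmult nn_integral_gaussian_density_exp(2)[OF C \<beta> pos])
  also have "\<dots> = ennreal (boltzmann_weight \<beta> C b / Z / 2 ^ CARD('n))"
    using Z by (simp add: ennreal_mult[symmetric] boltzmann_weight_def)
  finally show ?thesis by (simp add: Z_def)
qed

lemma emeasure_ising_law:
  fixes C :: "real^'n^'n"
  assumes [measurable]: "B \<in> sets borel"
  shows "emeasure (ising_law \<beta> C) B
    = (\<Sum>b\<in>spins \<inter> B. ennreal (boltzmann_weight \<beta> C b / partition_function \<beta> C / 2 ^ CARD('n)))"
proof -
  define w where "w b = boltzmann_weight \<beta> C b / partition_function \<beta> C" for b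
  have w: "w b \<ge> 0" for b
    using partition_function_pos[of \<beta> C] by (simp add: w_def boltzmann_weight_def)
  have [measurable]: "w \<in> borel_measurable borel"
    unfolding w_def boltzmann_weight_def by measurable
  have "emeasure (ising_law \<beta> C) B = (\<integral>\<^sup>+b. ennreal (w b) * indicator B b \<partial>measure_pmf uniform_spins)"
    unfolding ising_law_def w_def[symmetric] by (simp add: emeasure_density nn_integral_distr)
  also have "\<dots> = (\<Sum>b\<in>spins. ennreal (w b) * indicator B b) / ennreal (2 ^ CARD('n))"
    unfolding uniform_spins_eq
    by (simp add: nn_integral_pmf_of_set finite_spins spins_nonempty card_spins flip: ennreal_power)
  also have "(\<Sum>b\<in>spins. ennreal (w b) * indicator B b) = ennreal (\<Sum>b\<in>spins \<inter> B. w b)"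
    using w by (simp add: sum.inter_restrict finite_spins indicator_def if_distrib cong: if_cong flip: sum_ennreal)
  also have "ennreal (\<Sum>b\<in>spins \<inter> B. w b) / ennreal (2 ^ CARD('n)) = ennreal (\<Sum>b\<in>spins \<inter> B. w b / 2 ^ CARD('n))"
    using w by (subst divide_ennreal) (auto simp: sum_divide_distrib intro!: sum_nonneg)
  also have "\<dots> = (\<Sum>b\<in>spins \<inter> B. ennreal (w b / 2 ^ CARD('n)))"
    using w by (intro sum_ennreal[symmetric]) auto
  finally show ?thesis by (simp add: w_def)
qed

lemma emeasure_distr_spins:
  fixes W :: "'w \<Rightarrow> real^'n"
  assumes [measurable]: "W \<in> borel_measurable M" "B \<in> sets borel"
    and spins: "\<And>x. x \<in> space M \<Longrightarrow> W x \<in> spins"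
  shows "emeasure (distr M borel W) B = (\<Sum>b\<in>spins \<inter> B. emeasure M {x \<in> space M. W x = b})"
proof -
  have "emeasure (distr M borel W) B = emeasure M (W -` B \<inter> space M)"
    by (simp add: emeasure_distr)
  also have "W -` B \<inter> space M = (\<Union>b\<in>spins \<inter> B. {x \<in> space M. W x = b})"
    using spins by auto
  also have "emeasure M \<dots> = (\<Sum>b\<in>spins \<inter> B. emeasure M {x \<in> space M. W x = b})"
    by (intro sum_emeasure[symmetric]) (auto simp: disjoint_family_on_def finite_spins)
  finally show ?thesis .
qed

lemma transpose_adjacency_matrix: "transpose (adjacency_matrix E) = adjacency_matrix E"
  by (simp add: adjacency_matrix_def transpose_def vec_eq_iff insert_commute)

theorem lemmaA1:
  fixes E :: "'n::finite set set" and \<beta> \<gamma> :: real and C :: "real^'n^'n"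
    and M :: "'w measure" and V W :: "'w \<Rightarrow> real^'n"
  assumes "simple_graph E"
    and "\<beta> > 0"
    and "C = adjacency_matrix E + \<gamma> *\<^sub>R mat 1"
    and "invertible C"
  shows "((\<forall>v. v \<noteq> 0 \<longrightarrow> v \<bullet> (C *v v) > 0) \<longrightarrow> prob_space (field_law \<beta> C)) \<and>
         (random_vector M V \<and> distr M borel V = field_law \<beta> C \<and> randomised_spins M V W
            \<longrightarrow> distr M borel W = ising_law \<beta> C)"
proof -
  have sym: "transpose C = C"
    using transpose_adjacency_matrix[of E]
    by (simp add: assms(3) transpose_def vec_eq_iff mat_def eq_commute)
  note C = assms(4) sym
  have "prob_space (field_law \<beta> C)" if "\<forall>v. v \<noteq> 0 \<longrightarrow> v \<bullet> (C *v v) > 0"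
    using posdef_matrix_inv[OF C that] by (rule prob_space_field_law[OF C assms(2)])
  moreover have "distr M borel W = ising_law \<beta> C"
    if V: "random_vector M V" and law: "distr M borel V = field_law \<beta> C" and W: "randomised_spins M V W"
  proof (rule measure_eqI)
    show "sets (distr M borel W) = sets (ising_law \<beta> C)"
      by (simp add: ising_law_def)
    fix B assume "B \<in> sets (distr M borel W)"
    then have B [measurable]: "B \<in> sets borel" by simp
    have [measurable]: "V \<in> borel_measurable M" "W \<in> borel_measurable M"
      using V W by (simp_all add: random_vector_def randomised_spins_def)
    have "prob_space (field_law \<beta> C)"
      using V unfolding law[symmetric] random_vector_def by (auto intro: prob_space.prob_space_distr)
    note pos = posdef_of_prob_space_field_law[OF C assms(2) this]
    have "W x \<in> spins" if "x \<in> space M" for x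
      using W that by (simp add: randomised_spins_def spins_def)
    then have "emeasure (distr M borel W) B = (\<Sum>b\<in>spins \<inter> B. emeasure M {x \<in> space M. W x = b})"
      by (intro emeasure_distr_spins) auto
    also have "\<dots> = (\<Sum>b\<in>spins \<inter> B. ennreal (boltzmann_weight \<beta> C b / partition_function \<beta> C / 2 ^ CARD('n)))"
    proof (rule sum.cong[OF refl])
      fix b assume "b \<in> spins \<inter> B"
      then have b: "b \<in> spins" by simp
      have "emeasure M {x \<in> space M. W x = b} = (\<integral>\<^sup>+x. ennreal (\<Prod>i\<in>UNIV. logistic (b $ i * V x $ i)) \<partial>M)"
        by (rule prob_randomised_spins_eq[OF V W b])
      also have "\<dots> = (\<integral>\<^sup>+v. ennreal (\<Prod>i\<in>UNIV. logistic (b $ i * v $ i)) \<partial>distr M borel V)"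
        by (subst nn_integral_distr) (simp_all add: logistic_def)
      also have "\<dots> = ennreal (boltzmann_weight \<beta> C b / partition_function \<beta> C / 2 ^ CARD('n))"
        unfolding law by (rule nn_integral_field_law_logistic[OF C assms(2) pos b])
      finally show "emeasure M {x \<in> space M. W x = b}
          = ennreal (boltzmann_weight \<beta> C b / partition_function \<beta> C / 2 ^ CARD('n))" .
    qed
    also have "\<dots> = emeasure (ising_law \<beta> C) B"
      by (rule emeasure_ising_law[symmetric]) simp
    finally show "emeasure (distr M borel W) B = emeasure (ising_law \<beta> C) B" .
  qed
  ultimately show ?thesis by blast
qed

end
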